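(* Let $\Bbbk$ be a field of characteristic zero, $R=\Bbbk[u_1,\ldots,u_m]$, $(\alpha_{ij})\in M_{m\times n}(\Bbbk)$, $u=(u_1,\ldots,u_m)$ and $\alpha_i=(\alpha_{1i},\ldots,\alpha_{mi})$. If $p=(p_1,\ldots,p_n)\in R^n$ is monic and satisfies $$p_i(u-\tfrac{\alpha_j}{2})p_j(u-\tfrac{\alpha_i}{2})=p_i(u+\tfrac{\alpha_j}{2})p_j(u+\tfrac{\alpha_i}{2})\quad\forall i\neq j,$$ then $p$ also satisfies $$p_k(u-\tfrac{\alpha_i}{2}-\tfrac{\alpha_j}{2})p_k(u+\tfrac{\alpha_i}{2}+\tfrac{\alpha_j}{2})=p_k(u-\tfrac{\alpha_i}{2}+\tfrac{\alpha_j}{2})p_k(u+\tfrac{\alpha_i}{2}-\tfrac{\alpha_j}{2})\quad\forall i\neq j\neq k\neq i.$$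
   Context: Fix a monomial order on $R$ (e.g. lexicographic); a nonzero polynomial is monic if its leading monomial has coefficient $1$, and $p=(p_1,\ldots,p_n)\in R^n$ is monic if each $p_i$ is nonzero and monic. *)

theory Defs
  imports "HOL-Library.Poly_Mapping" "Jordan_Normal_Form.Matrix"
begin

(* A monomial is its finitely supported exponent vector, and a polynomial is a finitely
   supported map from monomials to coefficients; the product on poly_mapping is then the
   convolution, i.e. polynomial multiplication. Variables are numbered from 0, as are the
   indices of vectors and matrices. *)
type_synonym monom = "nat \<Rightarrow>\<^sub>0 nat"
type_synonym 'k mpoly = "monom \<Rightarrow>\<^sub>0 'k"

definition monoms :: "nat \<Rightarrow> monom set" where
  "monoms m = {t. Poly_Mapping.keys t \<subseteq> {..<m}}"

(* The ring k[u_0, ..., u_(m-1)]. *)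
definition mpolys :: "nat \<Rightarrow> 'k::zero mpoly set" where
  "mpolys m = {f. Poly_Mapping.keys f \<subseteq> monoms m}"

definition mconst :: "'k::zero \<Rightarrow> 'k mpoly" where
  "mconst c = Poly_Mapping.single 0 c"

definition mvar :: "nat \<Rightarrow> 'k::zero_neq_one mpoly" where
  "mvar i = Poly_Mapping.single (Poly_Mapping.single i 1) 1"

definition msubst :: "(nat \<Rightarrow> 'k mpoly) \<Rightarrow> 'k mpoly \<Rightarrow> 'k::comm_ring_1 mpoly" where
  "msubst \<sigma> f = (\<Sum>t\<in>Poly_Mapping.keys f. mconst (Poly_Mapping.lookup f t) *
      (\<Prod>i\<in>Poly_Mapping.keys t. \<sigma> i ^ Poly_Mapping.lookup t i))"

(* shift v f is f(u + v). It is meaningful only if f uses no variable beyond dim_vec v,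
   since v $ i is unspecified for larger i. *)
definition shift :: "'k vec \<Rightarrow> 'k mpoly \<Rightarrow> 'k::comm_ring_1 mpoly" where
  "shift v f = msubst (\<lambda>i. mvar i + mconst (v $ i)) f"

(* A pair (s, t) in r means that s is at most t. *)
definition monomial_order :: "nat \<Rightarrow> monom rel \<Rightarrow> bool" where
  "monomial_order m r \<longleftrightarrow> well_order_on (monoms m) r \<and>
     (\<forall>s t. \<forall>w\<in>monoms m. (s, t) \<in> r \<longrightarrow> (s + w, t + w) \<in> r)"

definition lead_monom :: "monom rel \<Rightarrow> 'k::zero mpoly \<Rightarrow> monom" where
  "lead_monom r f = (THE t. t \<in> Poly_Mapping.keys f \<and> (\<forall>s\<in>Poly_Mapping.keys f. (s, t) \<in> r))"

definition monic_wrt :: "monom rel \<Rightarrow> 'k::zero_neq_one mpoly \<Rightarrow> bool" where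
  "monic_wrt r f \<longleftrightarrow> f \<noteq> 0 \<and> Poly_Mapping.lookup f (lead_monom r f) = 1"

end

theory Submission
  imports Defs
begin

text \<open>Write \<open>a\<^sub>i = \<alpha>\<^sub>i / 2\<close>, \<open>X\<^sub>k = p\<^sub>k(u - a\<^sub>i - a\<^sub>j) p\<^sub>k(u + a\<^sub>i + a\<^sub>j)\<close> and
  \<open>Y\<^sub>k = p\<^sub>k(u - a\<^sub>i + a\<^sub>j) p\<^sub>k(u + a\<^sub>i - a\<^sub>j)\<close> for \<open>{i, j, k}\<close> a fixed triple. Shifting the
  hypothesis for \<open>(k, j)\<close> by \<open>a\<^sub>i\<close> and by \<open>- a\<^sub>i\<close> and cross-multiplying gives
  \<open>X\<^sub>k X\<^sub>j = Y\<^sub>k Y\<^sub>j\<close>. The same holds for the other two pairs, and combining all three yields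
  \<open>X\<^sub>k\<^sup>2 = Y\<^sub>k\<^sup>2\<close>. Since shifts preserve leading terms, \<open>X\<^sub>k\<close> and \<open>Y\<^sub>k\<close> have the same leading
  coefficient, which rules out \<open>X\<^sub>k = - Y\<^sub>k\<close> in characteristic zero.\<close>

section \<open>Substitution is a ring homomorphism\<close>

definition subst_monom :: "(nat \<Rightarrow> 'k mpoly) \<Rightarrow> monom \<Rightarrow> 'k::comm_ring_1 mpoly" where
  "subst_monom \<sigma> t = (\<Prod>i\<in>Poly_Mapping.keys t. \<sigma> i ^ Poly_Mapping.lookup t i)"

lemma msubst_alt:
  "msubst \<sigma> f = (\<Sum>t\<in>Poly_Mapping.keys f. mconst (Poly_Mapping.lookup f t) * subst_monom \<sigma> t)"
  by (simp add: msubst_def subst_monom_def)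

text \<open>Indices outside the support contribute a zeroth power, that is 1. Enlarging the index
  set lets two monomials be treated over one common set.\<close>

lemma subst_monom_superset:
  assumes "finite S" "Poly_Mapping.keys t \<subseteq> S"
  shows "subst_monom \<sigma> t = (\<Prod>i\<in>S. \<sigma> i ^ Poly_Mapping.lookup t i)"
  unfolding subst_monom_def
  by (rule prod.mono_neutral_left) (use assms in \<open>auto simp: in_keys_iff\<close>)

lemma subst_monom_0 [simp]: "subst_monom \<sigma> 0 = 1"
  by (simp add: subst_monom_def)

lemma subst_monom_add: "subst_monom \<sigma> (s + t) = subst_monom \<sigma> s * subst_monom \<sigma> t"
proof -
  let ?S = "Poly_Mapping.keys s \<union> Poly_Mapping.keys t"
  have "subst_monom \<sigma> (s + t) = (\<Prod>i\<in>?S. \<sigma> i ^ Poly_Mapping.lookup (s + t) i)"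
    by (rule subst_monom_superset) (simp_all add: keys_add)
  also have "\<dots> = (\<Prod>i\<in>?S. \<sigma> i ^ Poly_Mapping.lookup s i) * (\<Prod>i\<in>?S. \<sigma> i ^ Poly_Mapping.lookup t i)"
    by (simp add: lookup_add power_add prod.distrib)
  also have "\<dots> = subst_monom \<sigma> s * subst_monom \<sigma> t"
    by (simp add: subst_monom_superset[of ?S s] subst_monom_superset[of ?S t])
  finally show ?thesis .
qed

lemma mconst_0 [simp]: "mconst 0 = 0"
  by (simp add: mconst_def)

lemma mconst_1 [simp]: "mconst 1 = 1"
  by (simp add: mconst_def)

lemma mconst_add: "mconst (a + b) = mconst a + mconst b"
  by (simp add: mconst_def single_add)

lemma mconst_mult: "mconst (a * b) = mconst a * mconst b"
  by (simp add: mconst_def mult_single)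

lemma msubst_superset:
  assumes "finite S" "Poly_Mapping.keys f \<subseteq> S"
  shows "msubst \<sigma> f = (\<Sum>t\<in>S. mconst (Poly_Mapping.lookup f t) * subst_monom \<sigma> t)"
  unfolding msubst_alt
  by (rule sum.mono_neutral_left) (use assms in \<open>auto simp: in_keys_iff\<close>)

lemma msubst_add: "msubst \<sigma> (f + g) = msubst \<sigma> f + msubst \<sigma> g"
proof -
  let ?S = "Poly_Mapping.keys f \<union> Poly_Mapping.keys g"
  have "msubst \<sigma> (f + g) = (\<Sum>t\<in>?S. mconst (Poly_Mapping.lookup (f + g) t) * subst_monom \<sigma> t)"
    by (rule msubst_superset) (simp_all add: keys_add)
  also have "\<dots> = msubst \<sigma> f + msubst \<sigma> g"
    by (simp add: lookup_add mconst_add distrib_right sum.distrib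
        msubst_superset[of ?S f] msubst_superset[of ?S g])
  finally show ?thesis .
qed

lemma msubst_0 [simp]: "msubst \<sigma> 0 = 0"
  by (simp add: msubst_def)

lemma msubst_sum: "msubst \<sigma> (sum f S) = (\<Sum>x\<in>S. msubst \<sigma> (f x))"
  by (induction S rule: infinite_finite_induct) (simp_all add: msubst_add)

lemma msubst_single: "msubst \<sigma> (Poly_Mapping.single t c) = mconst c * subst_monom \<sigma> t"
  by (simp add: msubst_alt)

lemma sum_single_keys:
  "(\<Sum>t\<in>Poly_Mapping.keys f. Poly_Mapping.single t (Poly_Mapping.lookup f t)) = f"
  by (rule poly_mapping_eqI) (auto simp: lookup_sum lookup_single when_def in_keys_iff)

text \<open>Splitting both factors into single terms reduces the claim, by bilinearity, to
  multiplicativity on monomials.\<close>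

lemma msubst_mult: "msubst \<sigma> (f * g) = msubst \<sigma> f * msubst \<sigma> g"
proof -
  let ?term = "\<lambda>h t. Poly_Mapping.single t (Poly_Mapping.lookup h t)"
  have "msubst \<sigma> (f * g) =
      msubst \<sigma> ((\<Sum>s\<in>Poly_Mapping.keys f. ?term f s) * (\<Sum>t\<in>Poly_Mapping.keys g. ?term g t))"
    by (simp add: sum_single_keys)
  also have "\<dots> = msubst \<sigma> f * msubst \<sigma> g"
    by (simp add: sum_product mult_single msubst_sum msubst_single subst_monom_add mconst_mult
        msubst_alt[of \<sigma> f] msubst_alt[of \<sigma> g] ac_simps)
  finally show ?thesis .
qed

lemma msubst_mconst [simp]: "msubst \<sigma> (mconst c) = mconst c"
  by (simp add: mconst_def msubst_single)

lemma msubst_1 [simp]: "msubst \<sigma> 1 = 1"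
  using msubst_mconst[of \<sigma> 1] by simp

lemma msubst_mvar [simp]: "msubst \<sigma> (mvar i) = \<sigma> i"
  by (simp add: mvar_def msubst_single subst_monom_def)

lemma msubst_power: "msubst \<sigma> (f ^ n) = msubst \<sigma> f ^ n"
  by (induction n) (simp_all add: msubst_mult)

lemma msubst_prod: "msubst \<sigma> (prod f S) = (\<Prod>x\<in>S. msubst \<sigma> (f x))"
  by (induction S rule: infinite_finite_induct) (simp_all add: msubst_mult)

lemma msubst_msubst: "msubst \<sigma> (msubst \<tau> f) = msubst (\<lambda>i. msubst \<sigma> (\<tau> i)) f"
  unfolding msubst_def[of \<tau> f] msubst_def[of "\<lambda>i. msubst \<sigma> (\<tau> i)" f]
  by (simp add: msubst_sum msubst_mult msubst_prod msubst_power)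

lemma msubst_cong:
  assumes "f \<in> mpolys m" "\<And>i. i < m \<Longrightarrow> \<sigma> i = \<tau> i"
  shows "msubst \<sigma> f = msubst \<tau> f"
  using assms unfolding msubst_def mpolys_def monoms_def
  by (intro sum.cong refl arg_cong2[of _ _ _ _ "(*)"] prod.cong arg_cong2[of _ _ _ _ "(^)"]) auto

section \<open>Shifts of polynomials by vectors\<close>

lemma shift_mult: "shift v (f * g) = shift v f * shift v g"
  by (simp add: shift_def msubst_mult)

text \<open>Composing the substitutions adds the entries of the vectors. Entries are specified only
  below \<open>m\<close>, so \<open>msubst_cong\<close> restricts the comparison to variables that
  occur in \<open>f\<close>.\<close>

lemma shift_shift:
  assumes "f \<in> mpolys m" "v \<in> carrier_vec m" "w \<in> carrier_vec m"
  shows "shift v (shift w f) = shift (v + w) f"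
  unfolding shift_def msubst_msubst
  by (rule msubst_cong[OF assms(1)]) (use assms in \<open>simp add: msubst_add mconst_add ac_simps\<close>)

section \<open>Leading terms\<close>

text \<open>The leading monomial is taken with respect to the lexicographic order that the library
  puts on \<^typ>\<open>monom\<close>; any monomial order would serve. The coefficient \<open>c\<close> may be zero,
  so that the property is closed under products over any ring.\<close>

definition has_lead :: "monom \<Rightarrow> 'k \<Rightarrow> 'k::comm_ring_1 mpoly \<Rightarrow> bool" where
  "has_lead t c f \<longleftrightarrow> Poly_Mapping.keys (f - Poly_Mapping.single t c) \<subseteq> {..<t}"

lemma has_lead_lookup:
  assumes "has_lead t c f"
  shows "Poly_Mapping.lookup f t = c"
proof -
  have "t \<notin> Poly_Mapping.keys (f - Poly_Mapping.single t c)"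
    using assms by (auto simp: has_lead_def)
  then show ?thesis
    by (simp add: in_keys_iff lookup_minus)
qed

lemma has_lead_keys:
  assumes "has_lead t c f"
  shows "Poly_Mapping.keys f \<subseteq> {..t}"
proof -
  have "Poly_Mapping.keys f \<subseteq>
      Poly_Mapping.keys (f - Poly_Mapping.single t c) \<union> Poly_Mapping.keys (Poly_Mapping.single t c)"
    using keys_add[of "f - Poly_Mapping.single t c" "Poly_Mapping.single t c"] by simp
  also have "\<dots> \<subseteq> {..t}"
    using assms by (auto simp: has_lead_def split: if_splits)
  finally show ?thesis .
qed

lemma has_lead_single: "has_lead t c (Poly_Mapping.single t c)"
  by (simp add: has_lead_def)

lemma has_lead_1: "has_lead 0 1 1"
  using has_lead_single[of 0 1] by simp

lemma has_lead_mult: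
  assumes f: "has_lead s a f" and g: "has_lead t b g"
  shows "has_lead (s + t) (a * b) (f * g)"
proof -
  let ?f = "f - Poly_Mapping.single s a" and ?g = "g - Poly_Mapping.single t b"
  \<comment> \<open>Replacing one factor at a time by its leading term leaves two error terms; each
    pairs a strict bound on one factor with a weak bound on the other.\<close>
  have "f * g - Poly_Mapping.single (s + t) (a * b) = ?f * g + Poly_Mapping.single s a * ?g"
    by (simp add: algebra_simps mult_single)
  moreover have "Poly_Mapping.keys (?f * g) \<subseteq> {..<s + t}"
    using keys_mult[of ?f g] f has_lead_keys[OF g]
    by (fastforce simp: has_lead_def intro: add_less_le_mono)
  moreover have "Poly_Mapping.keys (Poly_Mapping.single s a * ?g) \<subseteq> {..<s + t}"
    using keys_mult[of "Poly_Mapping.single s a" ?g] g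
    by (fastforce simp: has_lead_def intro: add_strict_left_mono split: if_splits)
  ultimately show ?thesis
    using keys_add[of "?f * g" "Poly_Mapping.single s a * ?g"] by (auto simp: has_lead_def)
qed

lemma has_lead_power:
  assumes "has_lead (Poly_Mapping.single i 1) 1 f"
  shows "has_lead (Poly_Mapping.single i n) 1 (f ^ n)"
proof (induction n)
  case 0
  then show ?case using has_lead_1 by simp
next
  case (Suc n)
  then show ?case
    using has_lead_mult[OF assms Suc.IH] by (simp add: single_add[symmetric])
qed

lemma has_lead_prod:
  assumes "finite S" "\<And>i. i \<in> S \<Longrightarrow> has_lead (t i) 1 (f i)"
  shows "has_lead (sum t S) 1 (prod f S)"
  using assms
proof (induction S rule: finite_induct)
  case empty
  then show ?case using has_lead_1 by simp
next
  case (insert i S)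
  then show ?case
    using has_lead_mult[of "t i" 1 "f i" "sum t S" 1 "prod f S"] by simp
qed

section \<open>Invariance of leading terms under shifts\<close>

lemma single_pos: "(0::monom) < Poly_Mapping.single i 1"
  unfolding less_poly_mapping.rep_eq less_fun_def
  by (rule exI[of _ i]) (simp add: lookup_single when_def)

lemma has_lead_mvar_mconst: "has_lead (Poly_Mapping.single i 1) 1 (mvar i + mconst c)"
  using single_pos[of i] by (auto simp: has_lead_def mvar_def mconst_def split: if_splits)

lemma has_lead_shift_monom: "has_lead t 1 (subst_monom (\<lambda>i. mvar i + mconst (v $ i)) t)"
proof -
  have "has_lead (\<Sum>i\<in>Poly_Mapping.keys t. Poly_Mapping.single i (Poly_Mapping.lookup t i)) 1
      (subst_monom (\<lambda>i. mvar i + mconst (v $ i)) t)"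
    unfolding subst_monom_def
    by (intro has_lead_prod has_lead_power has_lead_mvar_mconst) simp
  then show ?thesis by (simp add: sum_single_keys)
qed

text \<open>A shifted monomial keeps itself as leading term, so the terms of \<open>f\<close> below
  \<open>T\<close> only produce monomials below \<open>T\<close>, and the term at \<open>T\<close>
  keeps its coefficient.\<close>

lemma has_lead_shift:
  assumes "has_lead T c f"
  shows "has_lead T c (shift v f)"
proof -
  let ?g = "f - Poly_Mapping.single T c"
  let ?M = "subst_monom (\<lambda>i. mvar i + mconst (v $ i))"
  have lead_term: "has_lead t a (mconst a * ?M t)" for t a
    using has_lead_mult[OF has_lead_single[of 0 a] has_lead_shift_monom[of t v]]
    by (simp add: mconst_def)
  have "shift v f = shift v ?g + mconst c * ?M T"
    using msubst_add[of _ ?g "Poly_Mapping.single T c"] by (simp add: shift_def msubst_single)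
  then have decomp: "shift v f - Poly_Mapping.single T c =
      shift v ?g + (mconst c * ?M T - Poly_Mapping.single T c)"
    by simp
  have "Poly_Mapping.keys (shift v ?g) \<subseteq> {..<T}"
  proof -
    have "Poly_Mapping.keys (shift v ?g) \<subseteq> (\<Union>t\<in>Poly_Mapping.keys ?g.
        Poly_Mapping.keys (mconst (Poly_Mapping.lookup ?g t) * ?M t))"
      unfolding shift_def msubst_alt by (rule keys_sum)
    also have "\<dots> \<subseteq> (\<Union>t\<in>Poly_Mapping.keys ?g. {..t})"
      by (intro UN_mono subset_refl has_lead_keys[OF lead_term])
    also have "\<dots> \<subseteq> {..<T}"
      using assms by (auto simp: has_lead_def)
    finally show ?thesis .
  qed
  moreover have "Poly_Mapping.keys (mconst c * ?M T - Poly_Mapping.single T c) \<subseteq> {..<T}"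
    using lead_term[of T c] by (simp add: has_lead_def)
  ultimately show ?thesis
    using keys_add[of "shift v ?g" "mconst c * ?M T - Poly_Mapping.single T c"]
    unfolding has_lead_def decomp by blast
qed

lemma has_lead_exists:
  assumes "f \<noteq> 0"
  obtains t c where "c \<noteq> 0" "has_lead t c f"
proof -
  let ?T = "Max (Poly_Mapping.keys f)"
  have ne: "Poly_Mapping.keys f \<noteq> {}"
    using assms by (metis keys_zero poly_mapping_eqI in_keys_iff lookup_zero empty_iff)
  have T: "?T \<in> Poly_Mapping.keys f" using ne by simp
  have "has_lead ?T (Poly_Mapping.lookup f ?T) f"
    unfolding has_lead_def
  proof
    fix s assume "s \<in> Poly_Mapping.keys (f - Poly_Mapping.single ?T (Poly_Mapping.lookup f ?T))"
    then have "s \<noteq> ?T" "s \<in> Poly_Mapping.keys f"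
      by (auto simp: in_keys_iff lookup_minus lookup_single when_def split: if_splits)
    then show "s \<in> {..<?T}"
      by (simp add: order_less_le)
  qed
  with T show thesis
    by (intro that) (auto simp: in_keys_iff)
qed

lemma shift_neq_0:
  assumes "f \<noteq> 0"
  shows "shift v f \<noteq> 0"
  using has_lead_exists[OF assms] has_lead_lookup[OF has_lead_shift] by (metis lookup_zero)

text \<open>Both products have coefficient \<open>c * c\<close> at \<open>t + t\<close>; a sign
  change would give \<open>2 * c * c = 0\<close>, impossible in characteristic zero for
  \<open>c\<close> nonzero.\<close>

lemma shift_mult_neq_uminus:
  fixes f :: "'k::field_char_0 mpoly"
  assumes "f \<noteq> 0"
  shows "shift v f * shift w f \<noteq> - (shift x f * shift y f)"
proof
  assume eq: "shift v f * shift w f = - (shift x f * shift y f)"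
  obtain t c where c: "c \<noteq> 0" and lead: "has_lead t c f"
    using has_lead_exists[OF assms] .
  have "Poly_Mapping.lookup (shift v f * shift w f) (t + t) = c * c" for v w
    by (intro has_lead_lookup has_lead_mult has_lead_shift lead)
  with eq have "c * c = - (c * c)"
    by (metis lookup_uminus)
  with c show False
    by simp
qed

section \<open>The triple relation\<close>

text \<open>The four shifts by plus or minus \<open>a\<close>, plus or minus \<open>b\<close> are
  the vertices of a parallelogram. One pair of opposite vertices is used here, the other pair in
  \<open>anti_prod\<close>.\<close>

definition diag_prod :: "'k vec \<Rightarrow> 'k vec \<Rightarrow> 'k mpoly \<Rightarrow> 'k::comm_ring_1 mpoly" where
  "diag_prod a b f = shift (- a - b) f * shift (a + b) f"

definition anti_prod :: "'k vec \<Rightarrow> 'k vec \<Rightarrow> 'k mpoly \<Rightarrow> 'k::comm_ring_1 mpoly" where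
  "anti_prod a b f = shift (- a + b) f * shift (a - b) f"

lemma diag_prod_commute:
  assumes "a \<in> carrier_vec m" "b \<in> carrier_vec m"
  shows "diag_prod a b f = diag_prod b a f"
proof -
  have "- a - b = - b - a" "a + b = b + a"
    using assms by auto
  then show ?thesis by (simp add: diag_prod_def)
qed

lemma anti_prod_commute:
  assumes "a \<in> carrier_vec m" "b \<in> carrier_vec m"
  shows "anti_prod a b f = anti_prod b a f"
proof -
  have "- a + b = b - a" "a - b = - b + a"
    using assms by auto
  then show ?thesis by (simp add: anti_prod_def mult.commute)
qed

text \<open>The hypothesis for a pair is shifted by the third vector \<open>c\<close> and by its
  negative. Multiplying one instance by the other read backwards regroups the eight shifts into the
  two kinds of product.\<close>

lemma diag_prod_mult_diag_prod:
  assumes vecs: "a \<in> carrier_vec m" "b \<in> carrier_vec m" "c \<in> carrier_vec m"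
    and polys: "f \<in> mpolys m" "g \<in> mpolys m"
    and eq: "shift (- b) f * shift (- a) g = shift b f * shift a g"
  shows "diag_prod c b f * diag_prod c a g = anti_prod c b f * anti_prod c a g"
proof -
  have shifted: "shift (v + - b) f * shift (v + - a) g = shift (v + b) f * shift (v + a) g"
    if "v \<in> carrier_vec m" for v
    using arg_cong[OF eq, of "shift v"] that vecs polys by (simp add: shift_mult shift_shift)
  have diffs: "c + - b = c - b" "c + - a = c - a" "- c + - b = - c - b" "- c + - a = - c - a"
    using vecs by auto
  have 1: "shift (c - b) f * shift (c - a) g = shift (c + b) f * shift (c + a) g"
    using shifted[of c] vecs by (simp add: diffs)
  have 2: "shift (- c - b) f * shift (- c - a) g = shift (- c + b) f * shift (- c + a) g"
    using shifted[of "- c"] vecs by (simp add: diffs)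
  have "diag_prod c b f * diag_prod c a g =
      (shift (- c - b) f * shift (- c - a) g) * (shift (c + b) f * shift (c + a) g)"
    by (simp add: diag_prod_def ac_simps)
  also have "\<dots> = (shift (- c + b) f * shift (- c + a) g) * (shift (c - b) f * shift (c - a) g)"
    by (simp only: 1 2)
  also have "\<dots> = anti_prod c b f * anti_prod c a g"
    by (simp add: anti_prod_def ac_simps)
  finally show ?thesis .
qed

text \<open>Multiplying the first two relations and cancelling the third leaves
  \<open>x\<^sup>2 = x'\<^sup>2\<close>, which in a domain determines \<open>x\<close> up to
  sign.\<close>

lemma square_eq_if_pairwise_products_eq:
  fixes x y z x' y' z' :: "'a::idom"
  assumes "x * y = x' * y'" "x * z = x' * z'" "y * z = y' * z'" "y \<noteq> 0" "z \<noteq> 0"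
  shows "x = x' \<or> x = - x'"
proof -
  have "(x * y) * (x * z) = (x' * y') * (x' * z')"
    by (simp only: assms(1,2))
  then have "x\<^sup>2 * (y * z) = x'\<^sup>2 * (y' * z')"
    by (simp add: power2_eq_square ac_simps)
  with assms show ?thesis
    by (simp add: power2_eq_iff flip: assms(3))
qed

lemma diag_prod_eq_anti_prod:
  fixes f g h :: "'k::field_char_0 mpoly"
  assumes vecs: "a \<in> carrier_vec m" "b \<in> carrier_vec m" "c \<in> carrier_vec m"
    and polys: "f \<in> mpolys m" "g \<in> mpolys m" "h \<in> mpolys m"
    and nz: "f \<noteq> 0" "g \<noteq> 0" "h \<noteq> 0"
    and fg: "shift (- b) f * shift (- a) g = shift b f * shift a g"
    and fh: "shift (- c) f * shift (- a) h = shift c f * shift a h"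
    and gh: "shift (- c) g * shift (- b) h = shift c g * shift b h"
  shows "diag_prod b c f = anti_prod b c f"
proof -
  \<comment> \<open>The shifting vector always comes first in
    \<open>diag_prod_mult_diag_prod\<close>; symmetry makes the three relations mention the same
    three products.\<close>
  note commute = diag_prod_commute[of _ m] anti_prod_commute[of _ m]
  have "diag_prod b c f * diag_prod a c g = anti_prod b c f * anti_prod a c g"
    using diag_prod_mult_diag_prod[OF vecs polys(1,2) fg]
    by (simp add: commute[OF vecs(3) vecs(1)] commute[OF vecs(3) vecs(2)])
  moreover have "diag_prod b c f * diag_prod a b h = anti_prod b c f * anti_prod a b h"
    using diag_prod_mult_diag_prod[OF vecs(1,3,2) polys(1,3) fh]
    by (simp add: commute[OF vecs(2) vecs(1)])
  moreover have "diag_prod a c g * diag_prod a b h = anti_prod a c g * anti_prod a b h"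
    using diag_prod_mult_diag_prod[OF vecs(2,3,1) polys(2,3) gh] .
  \<comment> \<open>Shifts of nonzero polynomials are nonzero and the polynomial ring is a domain,
    so both factors to be cancelled are nonzero.\<close>
  moreover have "diag_prod a c g \<noteq> 0" "diag_prod a b h \<noteq> 0"
    using nz by (simp_all add: diag_prod_def shift_neq_0)
  ultimately have "diag_prod b c f = anti_prod b c f \<or> diag_prod b c f = - anti_prod b c f"
    by (rule square_eq_if_pairwise_products_eq)
  then show ?thesis
    using shift_mult_neq_uminus[OF nz(1)] by (auto simp: diag_prod_def anti_prod_def)
qed

theorem corollary4p6:
  fixes m n :: nat
    and A :: "'k::field_char_0 mat"
    and \<alpha> :: "nat \<Rightarrow> 'k vec"
    and r :: "monom rel"
    and p :: "nat \<Rightarrow> 'k mpoly"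
  defines "\<alpha> \<equiv> col A"
  assumes "A \<in> carrier_mat m n"
    and "monomial_order m r"
    and "\<forall>i<n. p i \<in> mpolys m"
    and "\<forall>i<n. monic_wrt r (p i)"
    and "\<forall>i<n. \<forall>j<n. i \<noteq> j \<longrightarrow>
      shift (- ((1/2) \<cdot>\<^sub>v \<alpha> j)) (p i) * shift (- ((1/2) \<cdot>\<^sub>v \<alpha> i)) (p j) =
      shift ((1/2) \<cdot>\<^sub>v \<alpha> j) (p i) * shift ((1/2) \<cdot>\<^sub>v \<alpha> i) (p j)"
  shows "\<forall>i<n. \<forall>j<n. \<forall>k<n. i \<noteq> j \<and> j \<noteq> k \<and> k \<noteq> i \<longrightarrow>
      shift (- ((1/2) \<cdot>\<^sub>v \<alpha> i) - (1/2) \<cdot>\<^sub>v \<alpha> j) (p k) *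
      shift ((1/2) \<cdot>\<^sub>v \<alpha> i + (1/2) \<cdot>\<^sub>v \<alpha> j) (p k) =
      shift (- ((1/2) \<cdot>\<^sub>v \<alpha> i) + (1/2) \<cdot>\<^sub>v \<alpha> j) (p k) *
      shift ((1/2) \<cdot>\<^sub>v \<alpha> i - (1/2) \<cdot>\<^sub>v \<alpha> j) (p k)"
proof (intro allI impI, elim conjE)
  fix i j k
  assume lt: "i < n" "j < n" "k < n" and ne: "i \<noteq> j" "j \<noteq> k" "k \<noteq> i"
  have vec: "(1/2) \<cdot>\<^sub>v \<alpha> l \<in> carrier_vec m" for l
    using assms(2) by (simp add: \<alpha>_def carrier_vecI)
  have "diag_prod ((1/2) \<cdot>\<^sub>v \<alpha> i) ((1/2) \<cdot>\<^sub>v \<alpha> j) (p k) =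
      anti_prod ((1/2) \<cdot>\<^sub>v \<alpha> i) ((1/2) \<cdot>\<^sub>v \<alpha> j) (p k)"
    \<comment> \<open>The polynomial \<open>p k\<close> of the conclusion takes the role of
      \<open>f\<close>; each polynomial is paired with the half column of its own index.\<close>
    by (rule diag_prod_eq_anti_prod[OF vec[of k] vec[of i] vec[of j], of "p k" "p i" "p j"])
      (use assms(4-6) lt ne in \<open>auto simp: monic_wrt_def\<close>)
  then show "shift (- ((1/2) \<cdot>\<^sub>v \<alpha> i) - (1/2) \<cdot>\<^sub>v \<alpha> j) (p k) *
      shift ((1/2) \<cdot>\<^sub>v \<alpha> i + (1/2) \<cdot>\<^sub>v \<alpha> j) (p k) =
      shift (- ((1/2) \<cdot>\<^sub>v \<alpha> i) + (1/2) \<cdot>\<^sub>v \<alpha> j) (p k) *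
      shift ((1/2) \<cdot>\<^sub>v \<alpha> i - (1/2) \<cdot>\<^sub>v \<alpha> j) (p k)"
    by (simp add: diag_prod_def anti_prod_def)
qed

end
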